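(* Let $m\geq 1$ and let $L=\{1^{a_1},2^{a_2},\ldots,m^{a_m}\}$ with $a_1\geq a_2\geq\cdots\geq a_m>0$. Then $L$ has a standard linear realization.
   Context: The notation $\{1^{a_1},\ldots,m^{a_m}\}$ denotes the multiset with $a_i$ copies of $i$. For a list (multiset) $L$ of positive integers with $|L|$ elements, a linear realization of $L$ is an ordering $[x_0,\ldots,x_{|L|}]$ of $\{0,1,\ldots,|L|\}$ such that the multiset $\{|x_i-x_{i+1}|:0\le i\le |L|-1\}$ equals $L$; it is standard if $x_0=0$. *)

theory Defs
  imports Complex_Main "HOL-Library.Multiset"
begin

text \<open>\<open>L\<close> has \<open>size L\<close> elements, so a realization has \<open>size L + 1\<close> entries and the
  index of a consecutive pair runs over \<open>{0..<size L}\<close>. The difference is taken in the integers,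
  since subtraction on the natural numbers truncates.\<close>

definition linear_realization :: "nat multiset \<Rightarrow> nat list \<Rightarrow> bool" where
  "linear_realization L xs \<longleftrightarrow>
     distinct xs \<and> set xs = {0..size L} \<and>
     {# nat \<bar>int (xs ! i) - int (xs ! (i + 1))\<bar>. i \<in># mset_set {0..<size L} #} = L"

definition standard_linear_realization :: "nat multiset \<Rightarrow> nat list \<Rightarrow> bool" where
  "standard_linear_realization L xs \<longleftrightarrow> linear_realization L xs \<and> xs ! 0 = 0"

text \<open>The multiset \<open>{1^(a 1), ..., m^(a m)}\<close>; values of \<open>a\<close> outside \<open>{1..m}\<close> are ignored.\<close>

definition exponent_multiset :: "nat \<Rightarrow> (nat \<Rightarrow> nat) \<Rightarrow> nat multiset" where
  "exponent_multiset m a = (\<Sum>i = 1..m. replicate_mset (a i) i)"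

end

theory Submission
  imports Defs
begin

text \<open>
  Since the exponents decrease, \<open>L\<close> is a union of blocks \<open>{1, \<dots>, k}\<close>, which are appended in
  nondecreasing order of \<open>k\<close>. If the path so far covers \<open>{0, \<dots>, n}\<close> and ends at \<open>n - q\<close> with
  \<open>q < k\<close>, then a step of length \<open>k\<close> leads to one of the next \<open>k\<close> labels, and a graceful path
  (all step lengths \<open>1, \<dots>, k - 1\<close> occur once) with this starting point covers these labels.
  It ends less than \<open>k\<close> below the top, so the next block can be appended.

  It remains to find graceful paths on \<open>{0, \<dots>, m}\<close> with an arbitrary first label \<open>x\<close>, where
  \<open>2 x \<le> m\<close> by reflection. For \<open>3 x < m\<close> an outward zigzag followed by a jump into the unused
  interval reduces \<open>m\<close>. For larger \<open>x\<close> one uses paths that alternate between the labels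
  \<open>\<le> c\<close> and \<open>> c\<close>, with \<open>c = m div 2\<close>: reversing both sides of the cut turns the first label \<open>x\<close>
  into \<open>c - x\<close>. The one case that escapes, \<open>m = 3 x - 1\<close>, has an explicit path.
\<close>

section \<open>Paths with prescribed labels and step lengths\<close>

fun steps :: "int list \<Rightarrow> int list" where
  "steps (x # y # zs) = \<bar>x - y\<bar> # steps (y # zs)"
| "steps _ = []"

lemma steps_append:
  "xs \<noteq> [] \<Longrightarrow> ys \<noteq> [] \<Longrightarrow>
    steps (xs @ ys) = steps xs @ \<bar>last xs - hd ys\<bar> # steps ys"
proof (induction xs rule: steps.induct)
  case ("2_2" x)
  then show ?case by (cases ys) auto
qed auto

text \<open>Only pairs related by \<open>R\<close> are constrained: reversing both sides of a cut
  turns a step length into a function of itself only for pairs that straddle the cut.\<close>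

lemma steps_map:
  assumes "\<And>x y. x \<in> set xs \<Longrightarrow> y \<in> set xs \<Longrightarrow> R x y \<Longrightarrow> \<bar>f x - f y\<bar> = g \<bar>x - y\<bar>"
    and "successively R xs"
  shows "steps (map f xs) = map g (steps xs)"
  using assms by (induction xs rule: steps.induct) auto

lemma steps_conv_nth:
  "steps xs = map (\<lambda>i. \<bar>xs ! i - xs ! (i + 1)\<bar>) [0..<length xs - 1]"
proof (induction xs rule: steps.induct)
  case (1 x y zs)
  then show ?case
    by (simp add: upt_conv_Cons map_Suc_upt[symmetric] o_def del: upt_Suc)
qed auto

text \<open>Every step crosses every cut in \<open>C\<close>; only \<open>C = {}\<close> (no constraint) and \<open>C = {c}\<close> matter.\<close>

definition alternating :: "int set \<Rightarrow> int \<Rightarrow> int \<Rightarrow> bool" where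
  "alternating C x y \<longleftrightarrow> (\<forall>c\<in>C. (x \<le> c) \<noteq> (y \<le> c))"

definition snake :: "int set \<Rightarrow> int set \<Rightarrow> int set \<Rightarrow> int \<Rightarrow> int \<Rightarrow> bool" where
  "snake C S D x y \<longleftrightarrow>
    (\<exists>xs. xs \<noteq> [] \<and> hd xs = x \<and> last xs = y \<and> distinct xs \<and> set xs = S \<and>
      successively (alternating C) xs \<and> distinct (steps xs) \<and> set (steps xs) = D)"

definition graceful_from :: "int set \<Rightarrow> int \<Rightarrow> int \<Rightarrow> bool" where
  "graceful_from C m x \<longleftrightarrow> (\<exists>y. snake C {0..m} {1..m} x y)"

lemma snake_singleton: "snake C {x} {} x x"
  unfolding snake_def by (rule exI[of _ "[x]"]) simp

lemma snake_join:
  assumes "snake C S D x y" "snake C T E u v"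
    and "S \<inter> T = {}" "D \<inter> E = {}" "\<bar>y - u\<bar> \<notin> D \<union> E" "alternating C y u"
    and "S' = S \<union> T" "D' = insert \<bar>y - u\<bar> (D \<union> E)"
  shows "snake C S' D' x v"
proof -
  obtain xs where xs: "xs \<noteq> []" "hd xs = x" "last xs = y" "distinct xs" "set xs = S"
      "successively (alternating C) xs" "distinct (steps xs)" "set (steps xs) = D"
    using assms(1) unfolding snake_def by blast
  obtain ys where ys: "ys \<noteq> []" "hd ys = u" "last ys = v" "distinct ys" "set ys = T"
      "successively (alternating C) ys" "distinct (steps ys)" "set (steps ys) = E"
    using assms(2) unfolding snake_def by blast
  show ?thesis
    unfolding snake_def
    by (rule exI[of _ "xs @ ys"])
      (use xs ys assms(3-8) in \<open>auto simp: steps_append successively_append_iff\<close>)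
qed

lemma snake_map:
  assumes "snake C S D x y"
    and "inj_on f S" "inj_on g D"
    and R: "\<And>x y. x \<in> S \<Longrightarrow> y \<in> S \<Longrightarrow> alternating C x y \<Longrightarrow>
      alternating C' (f x) (f y) \<and> \<bar>f x - f y\<bar> = g \<bar>x - y\<bar>"
    and "S' = f ` S" "D' = g ` D" "x' = f x"
  shows "snake C' S' D' x' (f y)"
proof -
  obtain xs where xs: "xs \<noteq> []" "hd xs = x" "last xs = y" "distinct xs" "set xs = S"
      "successively (alternating C) xs" "distinct (steps xs)" "set (steps xs) = D"
    using assms(1) unfolding snake_def by blast
  have "steps (map f xs) = map g (steps xs)"
    by (rule steps_map[OF _ xs(6)]) (use R xs(5) in auto)
  moreover have "successively (alternating C') (map f xs)"
    unfolding successively_map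
    by (rule successively_mono[OF xs(6)]) (use R xs(5) in auto)
  ultimately show ?thesis
    unfolding snake_def
    by (intro exI[of _ "map f xs"])
      (use xs assms(2,3,5-7) in \<open>auto simp: hd_map last_map distinct_map\<close>)
qed

section \<open>Symmetries of graceful paths\<close>

lemma snake_translate:
  assumes "graceful_from C m x"
  shows "\<exists>y. snake ((\<lambda>c. c + k) ` C) {k..m + k} {1..m} (x + k) y"
proof -
  obtain y where "snake C {0..m} {1..m} x y"
    using assms unfolding graceful_from_def by blast
  then have "snake ((\<lambda>c. c + k) ` C) {k..m + k} {1..m} (x + k) (y + k)"
    by (rule snake_map[where f = "\<lambda>t. t + k" and g = "\<lambda>d. d"])
      (auto simp: alternating_def inj_on_def)
  then show ?thesis by blast
qed

text \<open>A cut \<open>c\<close> separates \<open>c\<close> from \<open>c + 1\<close>; reflected,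
  it separates \<open>m - c - 1\<close> from \<open>m - c\<close>, hence the shift by one.\<close>

lemma graceful_from_reflect:
  assumes "graceful_from C m x"
  shows "graceful_from ((\<lambda>c. m - 1 - c) ` C) m (m - x)"
proof -
  obtain y where "snake C {0..m} {1..m} x y"
    using assms unfolding graceful_from_def by blast
  then have "snake ((\<lambda>c. m - 1 - c) ` C) {0..m} {1..m} (m - x) (m - y)"
    by (rule snake_map[where f = "\<lambda>t. m - t" and g = "\<lambda>d. d"])
      (force simp: alternating_def inj_on_def)+
  then show ?thesis unfolding graceful_from_def by blast
qed

text \<open>Reversing the labels on each side of the cut \<open>c\<close> replaces every step \<open>d\<close> by \<open>m + 1 - d\<close>.\<close>

lemma graceful_from_reverse_sides:
  assumes "graceful_from {c} m x" "0 \<le> x" "x \<le> c" "c \<le> m"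
  shows "graceful_from {c} m (c - x)"
proof -
  let ?f = "\<lambda>t. if t \<le> c then c - t else m + c + 1 - t"
  obtain y where y: "snake {c} {0..m} {1..m} x y"
    using assms unfolding graceful_from_def by blast
  have "t \<in> ?f ` {0..m}" if "t \<in> {0..m}" for t
    by (rule image_eqI[of _ _ "?f t"]) (use that assms in auto)
  moreover have "?f ` {0..m} \<subseteq> {0..m}"
    using assms by auto
  ultimately have S: "{0..m} = ?f ` {0..m}"
    by blast
  have "t \<in> (\<lambda>d. m + 1 - d) ` {1..m}" if "t \<in> {1..m}" for t
    by (rule image_eqI[of _ _ "m + 1 - t"]) (use that in auto)
  then have D: "{1..m} = (\<lambda>d. m + 1 - d) ` {1..m}"
    by auto
  have "snake {c} {0..m} {1..m} (c - x) (?f y)"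
    by (rule snake_map[OF y _ _ _ S D])
      (use assms in \<open>auto simp: alternating_def inj_on_def split: if_splits\<close>)
  then show ?thesis unfolding graceful_from_def by blast
qed

lemma graceful_from_no_cut: "graceful_from C m x \<Longrightarrow> graceful_from {} m x"
  unfolding graceful_from_def snake_def alternating_def successively_conv_nth by auto

section \<open>Zigzags and peeling\<close>

text \<open>Along \<open>a, b, a - 1, b + 1, ...\<close> the step length grows by one each time, and
  every step crosses the gap between \<open>a\<close> and \<open>b\<close>.\<close>

lemma snake_outward:
  assumes "a < b" "\<forall>c\<in>C. a \<le> c \<and> c < b"
  shows "snake C ({a - int n..a} \<union> {b..b + int n}) {b - a..b - a + 2 * int n} a (b + int n)"
  using assms
proof (induction n arbitrary: a b)
  case 0
  have "snake C {a, b} {b - a} a b"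
    by (rule snake_join[OF snake_singleton[of C a] snake_singleton[of C b]])
      (use 0 in \<open>auto simp: alternating_def\<close>)
  then show ?case by (simp add: insert_commute)
next
  case (Suc n)
  have 1: "snake C {a, b} {b - a} a b"
    by (rule snake_join[OF snake_singleton[of C a] snake_singleton[of C b]])
      (use Suc.prems in \<open>auto simp: alternating_def\<close>)
  have 2: "snake C ({a - 1 - int n..a - 1} \<union> {b + 1..b + 1 + int n})
      {b + 1 - (a - 1)..b + 1 - (a - 1) + 2 * int n} (a - 1) (b + 1 + int n)"
    by (rule Suc.IH) (use Suc.prems in auto)
  have "snake C ({a - int (Suc n)..a} \<union> {b..b + int (Suc n)})
     {b - a..b - a + 2 * int (Suc n)} a (b + 1 + int n)"
    by (rule snake_join[OF 1 2]) (use Suc.prems in \<open>auto simp: alternating_def\<close>)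
  then show ?case by (simp add: algebra_simps)
qed

text \<open>Along \<open>a, b, a + 1, b - 1, ...\<close> the step length drops by one each time; the
  hypothesis keeps the two sides apart.\<close>

lemma snake_inward:
  assumes "a + 2 * int n < b"
  shows "snake {} ({a..a + int n} \<union> {b - int n..b}) {b - a - 2 * int n..b - a} a (b - int n)"
  using assms
proof (induction n arbitrary: a b)
  case 0
  have "snake {} {a, b} {b - a} a b"
    by (rule snake_join[OF snake_singleton[of _ a] snake_singleton[of _ b]])
      (use 0 in \<open>auto simp: alternating_def\<close>)
  then show ?case by (simp add: insert_commute)
next
  case (Suc n)
  have 1: "snake {} {a, b} {b - a} a b"
    by (rule snake_join[OF snake_singleton[of _ a] snake_singleton[of _ b]])
      (use Suc.prems in \<open>auto simp: alternating_def\<close>)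
  have 2: "snake {} ({a + 1..a + 1 + int n} \<union> {b - 1 - int n..b - 1})
      {b - 1 - (a + 1) - 2 * int n..b - 1 - (a + 1)} (a + 1) (b - 1 - int n)"
    by (rule Suc.IH) (use Suc.prems in auto)
  have "snake {} ({a..a + int (Suc n)} \<union> {b - int (Suc n)..b})
     {b - a - 2 * int (Suc n)..b - a} a (b - 1 - int n)"
    by (rule snake_join[OF 1 2]) (use Suc.prems in \<open>auto simp: alternating_def\<close>)
  then show ?case by (simp add: algebra_simps)
qed

text \<open>The path starts \<open>i, m - i, i - 1, m - i + 1, \<dots>, 0, m\<close> and then jumps to \<open>2 i + 1\<close>,
  which has position \<open>i\<close> among the unused labels.\<close>

lemma graceful_from_peel_even:
  assumes "0 \<le> i" "3 * i + 2 \<le> m" "\<forall>c\<in>C. 2 * i + 1 \<le> c \<and> c < m - i"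
    and "graceful_from ((\<lambda>c. c - i - 1) ` C) (m - 2 * i - 2) i"
  shows "graceful_from C m i"
proof -
  obtain y where "snake ((\<lambda>c. c + (i + 1)) ` (\<lambda>c. c - i - 1) ` C) {i + 1..m - 2 * i - 2 + (i + 1)}
      {1..m - 2 * i - 2} (i + (i + 1)) y"
    using snake_translate[OF assms(4)] by blast
  then have 2: "snake C {i + 1..m - i - 1} {1..m - 2 * i - 2} (2 * i + 1) y"
    by (simp add: image_image algebra_simps)
  have 1: "snake C ({0..i} \<union> {m - i..m}) {m - 2 * i..m} i m"
    using snake_outward[of i "m - i" C "nat i"] assms by (force simp: algebra_simps)
  \<comment> \<open>The jump from \<open>m\<close> to \<open>2 * i + 1\<close> has the one missing
    length, \<open>m - 2 * i - 1\<close>.\<close>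
  have "snake C {0..m} {1..m} i y"
    by (rule snake_join[OF 1 2]) (use assms in \<open>auto simp: alternating_def\<close>)
  then show ?thesis unfolding graceful_from_def by blast
qed

text \<open>The path starts \<open>i, m - i + 1, i - 1, m - i + 2, \<dots>, m, 0\<close> and then jumps to \<open>m - 2 i\<close>,
  which has position \<open>i\<close> from the top among the unused labels.\<close>

lemma graceful_from_peel_odd:
  assumes "0 \<le> i" "3 * i + 1 \<le> m" "\<forall>c\<in>C. i \<le> c \<and> c < m - 2 * i"
    and "graceful_from ((\<lambda>c. m - i - 1 - c) ` C) (m - 2 * i - 1) i"
  shows "graceful_from C m i"
proof -
  \<comment> \<open>The premise describes the reflected remainder, so that its first label is again
    \<open>i\<close>.\<close>
  have "graceful_from ((\<lambda>c. c - i - 1) ` C) (m - 2 * i - 1) (m - 3 * i - 1)"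
    using graceful_from_reflect[OF assms(4)] by (simp add: image_image algebra_simps)
  then obtain y where "snake ((\<lambda>c. c + (i + 1)) ` (\<lambda>c. c - i - 1) ` C)
      {i + 1..m - 2 * i - 1 + (i + 1)} {1..m - 2 * i - 1} (m - 3 * i - 1 + (i + 1)) y"
    using snake_translate by blast
  then have 2: "snake C {i + 1..m - i} {1..m - 2 * i - 1} (m - 2 * i) y"
    by (simp add: image_image algebra_simps)
  have 1: "snake C ({0..i} \<union> {m - i + 1..m}) {m - 2 * i + 1..m} i 0"
  proof (cases "i = 0")
    case True
    then show ?thesis using snake_singleton[of C 0] by simp
  next
    case False
    have 3: "snake C ({1..i} \<union> {m - i + 1..m}) {m - 2 * i + 1..m - 1} i m"
      using snake_outward[of i "m - i + 1" C "nat (i - 1)"] assms False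
      by (force simp: algebra_simps)
    show ?thesis
      by (rule snake_join[OF 3 snake_singleton[of C 0]])
        (use assms False in \<open>auto simp: alternating_def\<close>)
  qed
  have "snake C {0..m} {1..m} i y"
    by (rule snake_join[OF 1 2]) (use assms in \<open>auto simp: alternating_def\<close>)
  then show ?thesis unfolding graceful_from_def by blast
qed

section \<open>Graceful paths from an arbitrary first label\<close>

lemma graceful_from_middle:
  assumes "0 \<le> i"
  shows "graceful_from {i} (2 * i + 1) i"
proof -
  have "{0..i} \<union> {i + 1..2 * i + 1} = {0..2 * i + 1}" using assms by auto
  then have "snake {i} {0..2 * i + 1} {1..2 * i + 1} i (2 * i + 1)"
    using snake_outward[of i "i + 1" "{i}" "nat i"] assms by (simp add: algebra_simps)
  then show ?thesis unfolding graceful_from_def by blast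
qed

text \<open>Induction on \<open>c\<close>. For \<open>2 * i < c\<close>, unless
  \<open>c = 3 * i + 1\<close>, an even peel keeps the cut in the middle and lowers \<open>c\<close>
  to \<open>c - i - 1\<close>. Reversing both sides then gives \<open>2 * i > c\<close>; its fixed
  label \<open>2 * i = c\<close> is excluded.\<close>

lemma graceful_from_alternating_even:
  assumes "0 \<le> i" "i \<le> c" "2 * i \<noteq> c"
  shows "graceful_from {c} (2 * c + 1) i"
  using assms
proof (induction "nat c" arbitrary: c i rule: less_induct)
  case less
  have low: "graceful_from {c} (2 * c + 1) i" if i: "0 \<le> i" "2 * i < c" for i
  proof (cases "c = 3 * i + 1")
    case True
    \<comment> \<open>An even peel would lead to the cut \<open>2 * i\<close>, the excluded case;
      two odd peels lead to \<open>graceful_from_middle\<close> instead.\<close>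
    have "graceful_from {2 * i + 1} (4 * i + 2) i"
    proof (rule graceful_from_peel_odd)
      show "graceful_from ((\<lambda>c. 4 * i + 2 - i - 1 - c) ` {2 * i + 1}) (4 * i + 2 - 2 * i - 1) i"
        using graceful_from_middle[OF i(1)] by (simp add: algebra_simps)
    qed (use i in auto)
    then have "graceful_from ((\<lambda>c'. 2 * c + 1 - i - 1 - c') ` {c}) (2 * c + 1 - 2 * i - 1) i"
      using True by (simp add: algebra_simps)
    then show ?thesis
      by (rule graceful_from_peel_odd[rotated -1]) (use i in auto)
  next
    case False
    have "graceful_from {c - i - 1} (2 * (c - i - 1) + 1) i"
      by (rule less.hyps) (use i False in auto)
    then have "graceful_from ((\<lambda>c. c - i - 1) ` {c}) (2 * c + 1 - 2 * i - 2) i"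
      by (simp add: algebra_simps)
    then show ?thesis
      by (rule graceful_from_peel_even[rotated -1]) (use i in auto)
  qed
  show ?case
  proof (cases "2 * i < c")
    case True
    then show ?thesis using low less.prems by simp
  next
    case False
    then have "graceful_from {c} (2 * c + 1) (c - i)"
      using low less.prems by simp
    from graceful_from_reverse_sides[OF this] show ?thesis
      using less.prems by simp
  qed
qed

text \<open>One odd peel leads to the previous lemma with cut \<open>c - i - 1\<close>, whose
  excluded label means \<open>c = 3 * i + 1\<close>; the last hypothesis is the mirror image under
  \<open>i \<mapsto> c - i\<close>.\<close>

lemma graceful_from_alternating_odd:
  assumes "0 \<le> i" "i \<le> c" "2 * i \<noteq> c" "c \<noteq> 3 * i + 1" "c \<noteq> 3 * (c - i) + 1"
  shows "graceful_from {c} (2 * c) i"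
proof -
  have low: "graceful_from {c} (2 * c) i" if i: "0 \<le> i" "2 * i < c" "c \<noteq> 3 * i + 1" for i
  proof (rule graceful_from_peel_odd)
    have "graceful_from {c - i - 1} (2 * (c - i - 1) + 1) i"
      by (rule graceful_from_alternating_even) (use i in auto)
    then show "graceful_from ((\<lambda>c'. 2 * c - i - 1 - c') ` {c}) (2 * c - 2 * i - 1) i"
      by (simp add: algebra_simps)
  qed (use i in auto)
  show ?thesis
  proof (cases "2 * i < c")
    case True
    then show ?thesis using low assms by simp
  next
    case False
    then have "graceful_from {c} (2 * c) (c - i)"
      using low assms by simp
    from graceful_from_reverse_sides[OF this] show ?thesis
      using assms by simp
  qed
qed

text \<open>In this exceptional case the path starts \<open>x, 0, m, 1, m - 1, \<dots>, x - 1, m - x + 1\<close>: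
  the step lost by skipping \<open>x\<close> in the zigzag is the length of the initial step.\<close>

lemma graceful_from_skip:
  assumes "1 \<le> x" "x \<ge> 2 \<Longrightarrow> graceful_from {} (x - 2) 0"
  shows "graceful_from {} (3 * x - 1) x"
proof -
  have 1: "snake {} ({0..x - 1} \<union> {2 * x..3 * x - 1}) {x + 1..3 * x - 1} 0 (2 * x)"
    using snake_inward[of 0 "nat (x - 1)" "3 * x - 1"] assms by (force simp: algebra_simps)
  have 2: "snake {} ({0..x} \<union> {2 * x..3 * x - 1}) {x..3 * x - 1} x (2 * x)"
    by (rule snake_join[OF snake_singleton[of _ x] 1]) (use assms in \<open>auto simp: alternating_def\<close>)
  show ?thesis
  proof (cases "x = 1")
    case True
    have "{0..1} \<union> {2..2} = {0..2::int}" by auto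
    then show ?thesis using 2 True unfolding graceful_from_def by auto
  next
    case False
    then have "graceful_from {} (x - 2) 0" using assms by simp
    from snake_translate[OF this, of "x + 1"]
    obtain y where y: "snake {} {x + 1..x - 2 + (x + 1)} {1..x - 2} (0 + (x + 1)) y"
      by auto
    \<comment> \<open>The jump from \<open>2 * x\<close> to \<open>x + 1\<close> supplies the length
      \<open>x - 1\<close>.\<close>
    have "snake {} {0..3 * x - 1} {1..3 * x - 1} x y"
      by (rule snake_join[OF 2 y]) (use assms False in \<open>auto simp: alternating_def\<close>)
    then show ?thesis unfolding graceful_from_def by blast
  qed
qed

theorem graceful_path_from_any_label:
  assumes "0 \<le> x" "x \<le> m"
  shows "graceful_from {} m x"
  using assms
proof (induction "nat m" arbitrary: m x rule: less_induct)
  case less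
  have low: "graceful_from {} m x" if x: "0 \<le> x" "2 * x \<le> m" for x
  proof -
    consider "m = 0" | "3 * x + 1 \<le> m" | "m = 3 * x - 1" "1 \<le> x"
      | c where "m = 2 * c + 1" "m \<le> 3 * x" "1 \<le> x"
      | c where "m = 2 * c" "m \<le> 3 * x" "m \<noteq> 3 * x - 1" "1 \<le> x"
    proof (cases "even m")
      case True
      then obtain c where "m = 2 * c" by blast
      then show thesis using x that by (smt (verit))
    next
      case False
      then obtain c where "m = 2 * c + 1" by (rule oddE)
      then show thesis using x that by (smt (verit))
    qed
    then show ?thesis
    proof cases
      case 1
      then show ?thesis
        using x snake_singleton[of "{}" 0] unfolding graceful_from_def by auto
    next
      case 2
      show ?thesis
        by (rule graceful_from_peel_odd) (use 2 x less.hyps[of "m - 2 * x - 1" x] in auto)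
    next
      case 3
      have "graceful_from {} (x - 2) 0" if "x \<ge> 2"
        using less.hyps[of "x - 2" 0] that 3 by auto
      then show ?thesis using graceful_from_skip 3 by simp
    next
      case 4
      show ?thesis
        using graceful_from_no_cut[OF graceful_from_alternating_even[of x c]] 4 x by auto
    next
      case 5
      \<comment> \<open>Equality would say exactly \<open>m = 3 * x - 1\<close>.\<close>
      have "c \<noteq> 3 * (c - x) + 1" using 5 by presburger
      then show ?thesis
        using graceful_from_no_cut[OF graceful_from_alternating_odd[of x c]] 5 x by auto
    qed
  qed
  show ?case
  proof (cases "2 * x \<le> m")
    case True
    then show ?thesis using low less.prems by simp
  next
    case False
    then have "graceful_from {} m (m - x)"
      using low less.prems by simp
    from graceful_from_reflect[OF this] show ?thesis by simp
  qed
qed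

section \<open>Appending blocks and the resulting realization\<close>

lemma mset_set_atLeastAtMost_Suc:
  "mset_set {1..Suc n} = add_mset (Suc n) (mset_set {1..n})"
  by (simp add: atLeastAtMostSuc_conv)

lemma exponent_multiset_Suc:
  "exponent_multiset (Suc m) a = exponent_multiset m a + replicate_mset (a (Suc m)) (Suc m)"
  by (simp add: exponent_multiset_def)

lemma exponent_multiset_add_block:
  assumes "\<And>i. i \<in> {1..m} \<Longrightarrow> a i = Suc (b i)"
  shows "exponent_multiset m a = exponent_multiset m b + mset_set {1..m}"
  using assms
proof (induction m)
  case 0
  then show ?case by (simp add: exponent_multiset_def)
next
  case (Suc m)
  have "a (Suc m) = Suc (b (Suc m))" using Suc.prems by simp
  moreover have "exponent_multiset m a = exponent_multiset m b + mset_set {1..m}"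
    using Suc by simp
  ultimately show ?case
    unfolding exponent_multiset_Suc mset_set_atLeastAtMost_Suc by simp
qed

definition block_path :: "nat multiset \<Rightarrow> nat \<Rightarrow> int list \<Rightarrow> bool" where
  "block_path L m xs \<longleftrightarrow> xs \<noteq> [] \<and> hd xs = 0 \<and> distinct xs \<and> set xs = {0..int (size L)} \<and>
    mset (steps xs) = image_mset int L \<and> int (size L) - last xs < int m"

lemma block_path_append_block:
  assumes "block_path L m xs" "1 \<le> m"
  shows "\<exists>ys. block_path (L + mset_set {1..m}) m ys"
proof -
  let ?n = "int (size L)"
  have xs: "xs \<noteq> []" "hd xs = 0" "distinct xs" "set xs = {0..?n}"
      "mset (steps xs) = image_mset int L" "?n - last xs < int m"
    using assms unfolding block_path_def by auto
  have "last xs \<in> {0..?n}" using xs(1,4) last_in_set by blast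
  \<comment> \<open>The step of length \<open>m\<close> lands on \<open>last xs + int m\<close>;
    counted from the first new label \<open>?n + 1\<close> this is the first label required
    here.\<close>
  then have "graceful_from {} (int m - 1) (int m - 1 - (?n - last xs))"
    using xs(6) by (intro graceful_path_from_any_label) auto
  from snake_translate[OF this, of "?n + 1"]
  obtain y where "snake {} {?n + 1..?n + int m} {1..int m - 1} (last xs + int m) y"
    by (auto simp: algebra_simps)
  then obtain ys where ys: "ys \<noteq> []" "hd ys = last xs + int m" "distinct ys"
      "set ys = {?n + 1..?n + int m}" "distinct (steps ys)" "set (steps ys) = {1..int m - 1}"
    unfolding snake_def by blast
  have "mset (steps ys) = mset_set {1..int m - 1}"
    using ys(5,6) by (metis mset_set_set)
  moreover have "mset_set {1..int m} = add_mset (int m) (mset_set {1..int m - 1})"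
  proof -
    have "{1..int m} = insert (int m) {1..int m - 1}" using assms(2) by auto
    then show ?thesis by simp
  qed
  moreover have "mset_set {1..int m} = image_mset int (mset_set {1..m})"
    by (simp add: image_mset_mset_set image_int_atLeastAtMost)
  ultimately have "mset (steps (xs @ ys)) = image_mset int (L + mset_set {1..m})"
    using xs ys by (simp add: steps_append)
  moreover have "last ys \<ge> ?n + 1" using ys(1,4) last_in_set by fastforce
  ultimately have "block_path (L + mset_set {1..m}) m (xs @ ys)"
    unfolding block_path_def using xs ys by auto
  then show ?thesis by blast
qed

text \<open>Outer induction on \<open>m\<close>, inner on the last exponent: a positive one lets a
  block \<open>{1..m}\<close> be split off and appended last; at zero the largest length
  disappears.\<close>

lemma block_path_exists:
  assumes "1 \<le> m" "\<forall>i\<in>{1..<m}. a i \<ge> a (i + 1)"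
  shows "\<exists>xs. block_path (exponent_multiset m a) m xs"
  using assms
proof (induction m arbitrary: a)
  case 0
  then show ?case by simp
next
  case (Suc m)
  from Suc.prems(2) show ?case
  proof (induction "a (Suc m)" arbitrary: a)
    case 0
    show ?case
    proof (cases "m = 0")
      case True
      then have "block_path (exponent_multiset (Suc m) a) (Suc m) [0]"
        using 0 by (simp add: block_path_def exponent_multiset_def)
      then show ?thesis by blast
    next
      case False
      then obtain xs where "block_path (exponent_multiset m a) m xs"
        using Suc.IH[of a] 0 by auto
      then have "block_path (exponent_multiset (Suc m) a) (Suc m) xs"
        using 0 by (simp add: block_path_def exponent_multiset_Suc)
      then show ?thesis by blast
    qed
  next
    case (Suc k)
    \<comment> \<open>By monotonicity every exponent is positive, so the subtraction in
      \<open>b\<close> does not truncate.\<close>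
    have pos: "a i \<ge> Suc k" if "i \<le> Suc m" "1 \<le> i" for i
      using that
    proof (induction i rule: inc_induct)
      case base
      then show ?case using Suc by simp
    next
      case (step i)
      then have "a (i + 1) \<le> a i" using Suc.prems by simp
      then show ?case using step by simp
    qed
    define b where "b = (\<lambda>i. a i - 1)"
    have "k = b (Suc m)" "\<forall>i\<in>{1..<Suc m}. b (i + 1) \<le> b i"
      using Suc.hyps(2) Suc.prems by (auto simp: b_def diff_le_mono)
    then obtain xs where "block_path (exponent_multiset (Suc m) b) (Suc m) xs"
      using Suc.hyps(1) by blast
    moreover have "exponent_multiset (Suc m) a = exponent_multiset (Suc m) b + mset_set {1..Suc m}"
      by (rule exponent_multiset_add_block) (use pos in \<open>fastforce simp: b_def\<close>)
    ultimately show ?case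
      using block_path_append_block by simp
  qed
qed

theorem theorem6p6:
  fixes m :: nat and a :: "nat \<Rightarrow> nat"
  assumes "m \<ge> 1"
    and "\<forall>i\<in>{1..<m}. a i \<ge> a (i + 1)"
    and "a m > 0"
  shows "\<exists>xs. standard_linear_realization (exponent_multiset m a) xs"
proof -
  let ?L = "exponent_multiset m a"
  obtain xs where xs: "xs \<noteq> []" "hd xs = 0" "distinct xs" "set xs = {0..int (size ?L)}"
      "mset (steps xs) = image_mset int ?L"
    using block_path_exists[OF assms(1,2)] unfolding block_path_def by blast
  have nonneg: "xs ! i \<ge> 0" if "i < length xs" for i
    using nth_mem[OF that] xs(4) by auto
  have "length xs = card (set xs)" using xs(3) by (simp add: distinct_card)
  then have len: "length xs = Suc (size ?L)" using xs(4) by simp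
  have "set (map nat xs) = {0..size ?L}"
    using xs(4) by (simp add: image_int_atLeastAtMost[of 0, simplified, symmetric] image_image)
  moreover have "distinct (map nat xs)"
    using xs(3,4) by (auto simp: distinct_map inj_on_def)
  moreover have "{# nat \<bar>int (map nat xs ! i) - int (map nat xs ! (i + 1))\<bar>.
      i \<in># mset_set {0..<size ?L} #} = ?L"
  proof -
    have "{# nat \<bar>int (map nat xs ! i) - int (map nat xs ! (i + 1))\<bar>. i \<in># mset_set {0..<size ?L} #}
        = {# nat \<bar>xs ! i - xs ! (i + 1)\<bar>. i \<in># mset_set {0..<size ?L} #}"
      \<comment> \<open>For \<open>i < size ?L\<close> both indices lie in the list, where entries
        are nonnegative and \<open>int\<close> undoes \<open>nat\<close>.\<close>
      by (rule image_mset_cong) (use len nonneg in auto)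
    also have "\<dots> = image_mset nat (mset (steps xs))"
      by (simp add: steps_conv_nth len multiset.map_comp o_def)
    also have "\<dots> = ?L"
      using xs(5) by (simp add: multiset.map_comp o_def)
    finally show ?thesis .
  qed
  moreover have "map nat xs ! 0 = 0"
    using xs(1,2) by (simp add: hd_conv_nth)
  ultimately have "standard_linear_realization ?L (map nat xs)"
    unfolding standard_linear_realization_def linear_realization_def by blast
  then show ?thesis by blast
qed

end
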